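(* Let $L\ge1$ be a fixed integer, and write $\mathrm{EVM}=\mathbb{E}\left[\sqrt{\left(\sum_{l=1}^L g_l\right)/g_d}\right]$, where $g_d,g_1,\dots,g_L$ are mutually independent. (i) If $g_d$ is a unit-mean Rician power random variable with parameter $K$ and $g_1,\dots,g_L$ are identically distributed unit-mean Rician power random variables with parameter $K_I$, then $\mathrm{EVM}\to\sqrt{L}$ as $K\to\infty$ and $K_I\to\infty$. (ii) If $g_d$ is a unit-mean Nakagami power random variable with parameter $m>0.5$ and $g_1,\dots,g_L$ are identically distributed unit-mean Nakagami power random variables with parameter $m_I>0$, then $\mathrm{EVM}\to\sqrt{L}$ as $m\to\infty$ and $m_I\to\infty$.
   Context: Unit-mean Rician power random variable with parameter $K\ge0$: a positive random variable with density $$f(x)=(1+K)\,e^{-K}e^{-(1+K)x}\,I_0\!\left(2\sqrt{K(1+K)x}\right),\quad x>0,$$ where $I_0$ is the modified Bessel function of the first kind of order $0$. Unit-mean Nakagami power random variable with parameter $m>0$: a Gamma random variable with shape $m$ and scale $1/m$, i.e. density $\frac{m^m x^{m-1}e^{-mx}}{\Gamma(m)}$, $x>0$. EVM: a desired signal with fading power $g_d$ is received together with $L$ interferers with fading powers $g_1,\dots,g_L$; with unit symbol energy, and in the absence of noise (interference-limited system), $\mathrm{EVM}=\mathbb{E}\left[\sqrt{\left(\sum_{l=1}^L g_l\right)/g_d}\right]$. The limits $K,K_I\to\infty$ and $m,m_I\to\infty$ correspond to the desired signal and interferers experiencing no fading. *)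

theory Defs
  imports "HOL-Probability.Probability"
begin

definition bessel_I0 :: "real \<Rightarrow> real" where
  "bessel_I0 z = (\<Sum>k. (z / 2) ^ (2 * k) / (fact k)\<^sup>2)"

definition rician_density :: "real \<Rightarrow> real \<Rightarrow> real" where
  "rician_density K x =
     (if x > 0
      then (1 + K) * exp (- K) * exp (- (1 + K) * x) * bessel_I0 (2 * sqrt (K * (1 + K) * x))
      else 0)"

definition nakagami_density :: "real \<Rightarrow> real \<Rightarrow> real" where
  "nakagami_density m x =
     (if x > 0 then m powr m * x powr (m - 1) * exp (- m * x) / Gamma m else 0)"

(* Both densities vanish on the nonpositive reals, so these variables are positive almost surely;
   pointwise positivity is not demanded. *)

definition rician_power :: "'a measure \<Rightarrow> real \<Rightarrow> ('a \<Rightarrow> real) \<Rightarrow> bool" where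
  "rician_power M K X \<longleftrightarrow> K \<ge> 0 \<and> distributed M lborel X (\<lambda>x. ennreal (rician_density K x))"

definition nakagami_power :: "'a measure \<Rightarrow> real \<Rightarrow> ('a \<Rightarrow> real) \<Rightarrow> bool" where
  "nakagami_power M m X \<longleftrightarrow> m > 0 \<and> distributed M lborel X (\<lambda>x. ennreal (nakagami_density m x))"

(* Mutual independence of the L + 1 variables gd, g 1, ..., g L, with gd placed at index 0. *)
definition indep_powers ::
    "'a measure \<Rightarrow> nat \<Rightarrow> ('a \<Rightarrow> real) \<Rightarrow> (nat \<Rightarrow> 'a \<Rightarrow> real) \<Rightarrow> bool" where
  "indep_powers M L gd g \<longleftrightarrow>
     prob_space.indep_vars M (\<lambda>_. borel) (\<lambda>i. if i = 0 then gd else g i) {0..L}"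

definition EVM :: "'a measure \<Rightarrow> nat \<Rightarrow> ('a \<Rightarrow> real) \<Rightarrow> (nat \<Rightarrow> 'a \<Rightarrow> real) \<Rightarrow> real" where
  "EVM M L gd g = (\<integral>\<omega>. sqrt ((\<Sum>l=1..L. g l \<omega>) / gd \<omega>) \<partial>M)"

end

(*
  By independence the EVM is E[sqrt S] * E[gd^(-1/2)], where S is the sum of the interferers.
  Everything is controlled by the mean and the moment of order -1/2, through
    (3 - x)/2 <= x^(-1/2),   2 - x^(-1/2) <= sqrt x,   sqrt S <= (S / sqrt L + sqrt L) / 2,
  and sqrt S >= (sum of sqrt (g l)) / sqrt L. If all means are at most 1 and E[gd^(-1/2)] <= u,
  E[(g l)^(-1/2)] <= v, then sqrt L * (2 - v) <= EVM <= sqrt L * u, so it suffices that the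
  moment of order -1/2 has an upper bound tending to 1. For a gamma law of shape s > 1 this follows
  from x^(-1/2) <= (1 + 1/x)/2. A Rician power has E[1/x] infinite, but it is a Poisson(K) mixture
  of gamma laws of shape k + 1, in which only the component k = 0, of weight exp(-K), is not
  covered by that inequality.
*)

theory Submission
  imports Defs "HOL-Real_Asymp.Real_Asymp"
begin

section \<open>Gamma laws and their moments\<close>

text \<open>Shape \<open>s\<close> and rate \<open>c\<close> stay separate: the Nakagami law has
  \<open>s = c = m\<close>, while the mixture components of the Rician law have
  \<open>s = k + 1\<close> and \<open>c = 1 + K\<close>.\<close>

definition gamma_density :: "real \<Rightarrow> real \<Rightarrow> real \<Rightarrow> real" where
  "gamma_density s c x = (if x > 0 then c powr s * x powr (s - 1) * exp (- c * x) / Gamma s else 0)"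

lemma gamma_density_nonneg: "s > 0 \<Longrightarrow> gamma_density s c x \<ge> 0"
  by (simp add: gamma_density_def Gamma_real_pos less_imp_le)

lemma borel_measurable_gamma_density [measurable]: "gamma_density s c \<in> borel_measurable borel"
  unfolding gamma_density_def[abs_def] by measurable

text \<open>Euler's integral for \<open>Gamma s\<close> under the substitution t = c x.\<close>

lemma nn_integral_powr_times_exp:
  fixes s c :: real
  assumes "s > 0" "c > 0"
  shows "(\<integral>\<^sup>+x. ennreal (if x > 0 then x powr (s - 1) * exp (- c * x) else 0) \<partial>lborel)
           = ennreal (Gamma s / c powr s)"
proof -
  let ?f = "\<lambda>t. ennreal (indicator {0..} t * t powr (s - 1) / exp t)"
  \<comment> \<open>The summand \<open>0\<close> is the shift in the affine substitution rule, kept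
    so that its instance matches syntactically.\<close>
  have eq: "indicator {0..} (0 + c * x) * (0 + c * x) powr (s - 1) / exp (0 + c * x)
      = c powr (s - 1) * (if x > 0 then x powr (s - 1) * exp (- c * x) else 0)" for x
    using assms
    by (cases "x > 0")
      (auto simp: powr_mult exp_minus field_simps indicator_def zero_le_mult_iff)
  let ?I = "\<integral>\<^sup>+x. ennreal (if x > 0 then x powr (s - 1) * exp (- c * x) else 0) \<partial>lborel"
  have "ennreal (Gamma s) = ennreal \<bar>c\<bar> * (\<integral>\<^sup>+x. ?f (0 + c * x) \<partial>lborel)"
    unfolding Gamma_conv_nn_integral_real[OF assms(1)]
    using assms by (intro nn_integral_real_affine) auto
  also have "\<dots> = ennreal c * (ennreal (c powr (s - 1)) * ?I)"
    unfolding eq using assms by (simp add: ennreal_mult' nn_integral_cmult)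
  also have "\<dots> = ennreal (c powr s) * ?I"
    using assms powr_add[of c 1 "s - 1"]
    by (simp add: mult.assoc[symmetric] ennreal_mult'[symmetric])
  finally have *: "ennreal (Gamma s) = ennreal (c powr s) * ?I" .
  have "?I = ennreal (1 / c powr s) * (ennreal (c powr s) * ?I)"
    using assms by (simp add: mult.assoc[symmetric] ennreal_mult'[symmetric])
  also have "\<dots> = ennreal (Gamma s / c powr s)"
    unfolding *[symmetric] using assms by (simp add: ennreal_mult'[symmetric] Gamma_real_pos)
  finally show ?thesis .
qed

text \<open>Multiplying the density by \<open>x powr r\<close> only shifts the shape from
  \<open>s\<close> to \<open>s + r\<close>, so the previous integral applies. The exponents of
  interest are 1, 0, -1 and -1/2.\<close>

lemma nn_integral_gamma_density_powr:
  fixes s c r :: real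
  assumes "s > 0" "c > 0" "s + r > 0"
  shows "(\<integral>\<^sup>+x. ennreal (gamma_density s c x * x powr r) \<partial>lborel)
           = ennreal (Gamma (s + r) / (Gamma s * c powr r))"
proof -
  have pos: "Gamma s > 0" "Gamma (s + r) > 0"
    using assms by (simp_all add: Gamma_real_pos)
  have "gamma_density s c x * x powr r
      = c powr s / Gamma s * (if x > 0 then x powr (s + r - 1) * exp (- c * x) else 0)" for x
    using powr_add[of x "s - 1" r] by (auto simp: gamma_density_def algebra_simps)
  then have "ennreal (gamma_density s c x * x powr r) = ennreal (c powr s / Gamma s)
      * ennreal (if x > 0 then x powr (s + r - 1) * exp (- c * x) else 0)" for x
    using pos by (simp only:) (intro ennreal_mult', simp)
  then have "(\<integral>\<^sup>+x. ennreal (gamma_density s c x * x powr r) \<partial>lborel)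
      = ennreal (c powr s / Gamma s) * ennreal (Gamma (s + r) / c powr (s + r))"
    using nn_integral_powr_times_exp[of "s + r" c] assms by (simp add: nn_integral_cmult)
  also have "\<dots> = ennreal (Gamma (s + r) / (Gamma s * c powr r))"
    using assms pos by (simp add: ennreal_mult'[symmetric] powr_add)
  finally show ?thesis .
qed

lemma nn_integral_gamma_density_mean:
  assumes "s > 0" "c > 0"
  shows "(\<integral>\<^sup>+x. ennreal (gamma_density s c x * x) \<partial>lborel) = ennreal (s / c)"
proof -
  have "Gamma (s + 1) = s * Gamma s"
    using assms by (intro Gamma_plus1) auto
  moreover have "Gamma s \<noteq> 0"
    using Gamma_real_pos[OF assms(1)] by (rule less_imp_neq[THEN not_sym])
  moreover have "(\<integral>\<^sup>+x. ennreal (gamma_density s c x * x) \<partial>lborel)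
      = (\<integral>\<^sup>+x. ennreal (gamma_density s c x * x powr 1) \<partial>lborel)"
    by (intro nn_integral_cong) (simp add: gamma_density_def)
  then have "(\<integral>\<^sup>+x. ennreal (gamma_density s c x * x) \<partial>lborel)
      = ennreal (Gamma (s + 1) / (Gamma s * c powr 1))"
    using nn_integral_gamma_density_powr[of s c 1] assms by (simp only:)
  ultimately show ?thesis
    using assms by simp
qed

text \<open>The arithmetic-geometric mean inequality for 1 and 1/x.\<close>

lemma inverse_sqrt_le:
  fixes x :: real
  assumes "x > 0"
  shows "1 / sqrt x \<le> (1 + 1 / x) / 2"
  using arith_geo_mean_sqrt[of 1 "1 / x"] assms by (simp add: real_sqrt_divide)

lemma ennreal_half_sum:
  assumes "p \<ge> 0" "q \<ge> 0"
  shows "ennreal (1/2 * p + 1/2 * q) = ennreal (1/2) * ennreal p + ennreal (1/2) * ennreal q"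
  using assms by (simp only: ennreal_plus ennreal_mult mult_nonneg_nonneg zero_le_divide_1_iff
      zero_le_numeral)

text \<open>The pointwise bound (1 + 1/x)/2 is integrated: the total mass is 1, and the moment of
  order -1 is c/(s - 1), which is where \<open>s > 1\<close> enters.\<close>

lemma nn_integral_gamma_density_inverse_sqrt_le:
  assumes "s > 1" "c > 0"
  shows "(\<integral>\<^sup>+x. ennreal (gamma_density s c x * (1 / sqrt x)) \<partial>lborel)
           \<le> ennreal ((1 + c / (s - 1)) / 2)"
proof -
  have pos: "Gamma s > 0" "Gamma (s - 1) > 0"
    using assms by (simp_all add: Gamma_real_pos)
  have G: "Gamma s = (s - 1) * Gamma (s - 1)"
    using Gamma_plus1[of "s - 1"] nonpos_Ints_nonpos[of "s - 1"] assms by auto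
  \<comment> \<open>The constant 1 is written as \<open>x powr 0\<close>, so that one moment formula
    evaluates both terms.\<close>
  have le: "gamma_density s c x * (1 / sqrt x)
      \<le> 1/2 * (gamma_density s c x * x powr 0) + 1/2 * (gamma_density s c x * x powr (-1))" for x
  proof (cases "x > 0")
    case True
    then show ?thesis
      using mult_left_mono[OF inverse_sqrt_le[OF True] gamma_density_nonneg[of s c x]] assms
      by (simp add: powr_minus_divide field_simps)
  qed (simp add: gamma_density_def)
  have "(\<integral>\<^sup>+x. ennreal (gamma_density s c x * (1 / sqrt x)) \<partial>lborel)
      \<le> (\<integral>\<^sup>+x. ennreal (1/2) * ennreal (gamma_density s c x * x powr 0)
           + ennreal (1/2) * ennreal (gamma_density s c x * x powr (-1)) \<partial>lborel)"
  proof (intro nn_integral_mono)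
    fix x
    let ?p = "gamma_density s c x * x powr 0" and ?q = "gamma_density s c x * x powr (-1)"
    have "?p \<ge> 0" "?q \<ge> 0"
      using assms by (auto intro!: mult_nonneg_nonneg gamma_density_nonneg)
    then show "ennreal (gamma_density s c x * (1 / sqrt x))
        \<le> ennreal (1/2) * ennreal ?p + ennreal (1/2) * ennreal ?q"
      using ennreal_leI[OF le[of x]] by (simp only: ennreal_half_sum)
  qed
  also have "\<dots> = ennreal (1/2) * ennreal (Gamma (s + 0) / (Gamma s * c powr 0))
      + ennreal (1/2) * ennreal (Gamma (s + (-1)) / (Gamma s * c powr (-1)))"
  proof -
    have "s > 0" "s + 0 > 0" "s + (-1) > 0"
      using assms(1) by auto
    then show ?thesis
      using assms(2)
      by (subst nn_integral_add, measurable, subst (1 2) nn_integral_cmult, measurable)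
        (simp only: nn_integral_gamma_density_powr)
  qed
  also have "\<dots> = ennreal (1/2 * (Gamma (s + 0) / (Gamma s * c powr 0))
      + 1/2 * (Gamma (s + (-1)) / (Gamma s * c powr (-1))))"
    using assms pos by (intro ennreal_half_sum[symmetric]) auto
  also have "1/2 * (Gamma (s + 0) / (Gamma s * c powr 0))
      + 1/2 * (Gamma (s + (-1)) / (Gamma s * c powr (-1))) = (1 + c / (s - 1)) / 2"
    using assms less_imp_neq[OF pos(2)] by (simp add: G powr_minus_divide add_divide_distrib)
  finally show ?thesis .
qed

section \<open>Moment conditions on a fading power; the Nakagami case\<close>

text \<open>This is all that the estimates of the EVM use about a fading law. The moments are
  nonnegative integrals, so that their finiteness is part of the bounds.\<close>

definition unit_power :: "'a measure \<Rightarrow> real \<Rightarrow> ('a \<Rightarrow> real) \<Rightarrow> bool" where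
  "unit_power M u X \<longleftrightarrow> X \<in> borel_measurable M \<and> (AE \<omega> in M. X \<omega> > 0) \<and> u \<ge> 0 \<and>
     (\<integral>\<^sup>+\<omega>. ennreal (X \<omega>) \<partial>M) \<le> 1 \<and> (\<integral>\<^sup>+\<omega>. ennreal (1 / sqrt (X \<omega>)) \<partial>M) \<le> ennreal u"

text \<open>Both moments become integrals against the density, and a density vanishing on the
  nonpositive reals makes the variable positive almost surely.\<close>

lemma (in prob_space) unit_power_distributed:
  fixes f :: "real \<Rightarrow> real"
  assumes D: "distributed M lborel X (\<lambda>x. ennreal (f x))"
    and nonneg: "\<And>x. f x \<ge> 0" and zero: "\<And>x. x \<le> 0 \<Longrightarrow> f x = 0" and "u \<ge> 0"
    and mean: "(\<integral>\<^sup>+x. ennreal (f x * x) \<partial>lborel) \<le> 1"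
    and inv: "(\<integral>\<^sup>+x. ennreal (f x * (1 / sqrt x)) \<partial>lborel) \<le> ennreal u"
  shows "unit_power M u X"
  unfolding unit_power_def
proof (intro conjI)
  show "X \<in> borel_measurable M"
    using distributed_measurable[OF D] by simp
  show "AE \<omega> in M. X \<omega> > 0"
    by (subst distributed_AE2[OF D]) (use zero in \<open>auto simp: not_le[symmetric]\<close>)
  show "(\<integral>\<^sup>+\<omega>. ennreal (X \<omega>) \<partial>M) \<le> 1"
    using mean nonneg
    by (subst distributed_nn_integral[OF D, symmetric]) (auto simp: ennreal_mult')
  show "(\<integral>\<^sup>+\<omega>. ennreal (1 / sqrt (X \<omega>)) \<partial>M) \<le> ennreal u"
    using inv nonneg
    by (subst distributed_nn_integral[OF D, symmetric]) (auto simp: ennreal_mult'[symmetric])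
qed fact

text \<open>The law is gamma with shape and rate both \<open>m\<close>, hence of mean m/m = 1. The
  restriction \<open>m > 1\<close> keeps the moment of order -1 finite and is harmless as m tends to
  infinity.\<close>

lemma (in prob_space) nakagami_unit_power:
  assumes "nakagami_power M m X" "m > 1"
  shows "unit_power M ((1 + m / (m - 1)) / 2) X"
proof (rule unit_power_distributed)
  have eq: "nakagami_density m = gamma_density m m"
    by (simp add: fun_eq_iff nakagami_density_def gamma_density_def)
  show "distributed M lborel X (\<lambda>x. ennreal (nakagami_density m x))"
    using assms by (simp add: nakagami_power_def)
  show "nakagami_density m x \<ge> 0" for x
    using assms by (simp add: eq gamma_density_nonneg)
  show "(\<integral>\<^sup>+x. ennreal (nakagami_density m x * x) \<partial>lborel) \<le> 1"
    using assms by (simp add: eq nn_integral_gamma_density_mean)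
  show "(\<integral>\<^sup>+x. ennreal (nakagami_density m x * (1 / sqrt x)) \<partial>lborel)
      \<le> ennreal ((1 + m / (m - 1)) / 2)"
    using assms unfolding eq by (intro nn_integral_gamma_density_inverse_sqrt_le) auto
qed (use assms in \<open>auto simp: nakagami_density_def\<close>)

section \<open>The Rician law as a Poisson mixture of gamma laws\<close>

text \<open>Comparison with the exponential series. Convergence is what gives the
  \<open>suminf\<close> in \<open>bessel_I0\<close> its meaning.\<close>

lemma summable_power_over_fact_squared:
  fixes z :: real
  assumes "z \<ge> 0"
  shows "summable (\<lambda>k. z ^ k / (fact k)\<^sup>2)"
proof (rule summable_comparison_test')
  show "summable (\<lambda>k. z ^ k /\<^sub>R fact k)"
    by (rule summable_exp_generic)
  show "norm (z ^ k / (fact k)\<^sup>2) \<le> z ^ k /\<^sub>R fact k" for k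
  proof -
    have "z ^ k / (fact k)\<^sup>2 \<le> z ^ k / fact k"
      using assms by (intro divide_left_mono) (auto simp: power2_eq_square)
    then show ?thesis
      using assms by (simp add: divide_inverse mult.commute)
  qed
qed

text \<open>In the Bessel series at z = K (1 + K) x, one factor k! of the k-th term goes to the
  Poisson weight and the other is \<open>Gamma (k + 1)\<close>; the powers of (1 + K) x complete the
  gamma density.\<close>

lemma rician_density_sums:
  assumes "K \<ge> 0"
  shows "(\<lambda>k. exp (- K) * K ^ k / fact k * gamma_density (real k + 1) (1 + K) x)
           sums rician_density K x"
proof (cases "x > 0")
  case True
  let ?z = "K * (1 + K) * x"
  have "?z \<ge> 0"
    using assms True by simp
  then have I0: "(\<lambda>k. ?z ^ k / (fact k)\<^sup>2) sums bessel_I0 (2 * sqrt ?z)"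
    using summable_sums[OF summable_power_over_fact_squared[of ?z]]
    by (simp add: bessel_I0_def power_mult real_sqrt_pow2)
  have "exp (- K) * K ^ k / fact k * gamma_density (real k + 1) (1 + K) x
      = (1 + K) * exp (- K) * exp (- (1 + K) * x) * (?z ^ k / (fact k)\<^sup>2)" for k
    using True assms Gamma_fact[of k, where 'a = real]
    by (simp add: gamma_density_def powr_realpow powr_add power_mult_distrib power2_eq_square
        add.commute)
  then show ?thesis
    using sums_mult[OF I0] True by (simp add: rician_density_def)
qed (simp add: gamma_density_def rician_density_def)

lemma rician_density_nonneg: "K \<ge> 0 \<Longrightarrow> rician_density K x \<ge> 0"
  using sums_le[OF _ sums_zero rician_density_sums[of K x]] by (simp add: gamma_density_nonneg)

text \<open>Sum and integral commute by nonnegativity, so bounds for the components average with the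
  Poisson weights. Nonnegativity of \<open>h\<close> is asked only on the positive reals, since
  \<open>x\<close> and \<open>1 / sqrt x\<close> are negative to the left of 0.\<close>

lemma nn_integral_rician_density_le:
  fixes b :: "nat \<Rightarrow> real" and h :: "real \<Rightarrow> real"
  assumes "K \<ge> 0" and [measurable]: "h \<in> borel_measurable borel" and h: "\<And>x. x > 0 \<Longrightarrow> h x \<ge> 0"
    and b: "\<And>k. (\<integral>\<^sup>+x. ennreal (gamma_density (real k + 1) (1 + K) x * h x) \<partial>lborel)
              \<le> ennreal (b k)" "\<And>k. b k \<ge> 0"
    and sums: "(\<lambda>k. exp (- K) * K ^ k / fact k * b k) sums t"
  shows "(\<integral>\<^sup>+x. ennreal (rician_density K x * h x) \<partial>lborel) \<le> ennreal t"
proof -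
  let ?w = "\<lambda>k. exp (- K) * K ^ k / fact k"
  let ?g = "\<lambda>k x. gamma_density (real k + 1) (1 + K) x * h x"
  have nonneg: "?g k x \<ge> 0" for k x
    using h[of x] gamma_density_nonneg[of "real k + 1" "1 + K" x]
    by (cases "x > 0") (auto simp: gamma_density_def)
  have "ennreal (rician_density K x * h x) = (\<Sum>k. ennreal (?w k) * ennreal (?g k x))" for x
    using sums_mult2[OF rician_density_sums[OF assms(1), of x], of "h x"] nonneg[of _ x] assms(1)
    by (subst suminf_ennreal_eq[symmetric]) (auto simp: ennreal_mult[symmetric] mult.assoc)
  then have "(\<integral>\<^sup>+x. ennreal (rician_density K x * h x) \<partial>lborel)
      = (\<Sum>k. ennreal (?w k) * (\<integral>\<^sup>+x. ennreal (?g k x) \<partial>lborel))"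
    by (simp add: nn_integral_suminf nn_integral_cmult)
  also have "\<dots> \<le> (\<Sum>k. ennreal (?w k) * ennreal (b k))"
    by (intro suminf_le mult_left_mono b) auto
  also have "\<dots> = (\<Sum>k. ennreal (?w k * b k))"
    using assms(1) by (intro suminf_cong ennreal_mult'[symmetric]) simp
  also have "\<dots> = ennreal t"
    using assms(1) b by (intro suminf_ennreal_eq sums) auto
  finally show ?thesis .
qed

lemma poisson_sums:
  fixes K :: real
  shows "(\<lambda>k. exp (- K) * K ^ k / fact k) sums 1"
  using sums_mult[OF exp_converges[of K], of "exp (- K)"]
  by (simp add: divide_inverse mult.commute mult.left_commute exp_minus)

text \<open>Dividing a Poisson weight by k + 1, or by (k + 1) (k + 2), gives a multiple of a shifted
  weight; such averages are therefore tail probabilities up to a power of K.\<close>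

lemma poisson_shift_sums:
  fixes K :: real
  shows "(\<lambda>k. exp (- K) * K ^ (k + n) / fact (k + n))
           sums (1 - (\<Sum>i<n. exp (- K) * K ^ i / fact i))"
  using sums_split_initial_segment[OF poisson_sums[of K], of n] by simp

text \<open>The component \<open>k > 0\<close> of the mixture contributes \<open>1 / k\<close>, which is replaced by
  \<open>1 / (k + 1) + 3 / ((k + 1) * (k + 2))\<close> because the Poisson averages of these terms are explicit.\<close>

definition rician_bound :: "real \<Rightarrow> real" where
  "rician_bound K = exp (- K) * sqrt (pi * (1 + K)) + (1 + (1 + K) * (1 / K + 3 / K\<^sup>2)) / 2"

lemma (in prob_space) rician_unit_power:
  assumes "rician_power M K X" "K > 0"
  shows "unit_power M (rician_bound K) X"
proof (rule unit_power_distributed)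
  show "distributed M lborel X (\<lambda>x. ennreal (rician_density K x))"
    using assms by (simp add: rician_power_def)
  let ?w = "\<lambda>k. exp (- K) * K ^ k / fact k"
  \<comment> \<open>Component k has mean (k + 1)/(1 + K), and the Poisson mean is K, so the mixture
    has mean 1.\<close>
  have "(\<lambda>k. ?w k * ((real k + 1) / (1 + K))) sums 1"
  proof -
    have "(\<lambda>k. ?w (Suc k) * real (Suc k)) sums K"
      using sums_mult[OF poisson_sums[of K], of K] by (simp add: field_simps del: of_nat_Suc)
    then have "(\<lambda>k. ?w k * real k) sums K"
      by (subst (asm) sums_Suc_iff) simp
    from sums_divide[OF sums_add[OF this poisson_sums[of K]], of "1 + K"]
    show ?thesis
      using assms by (simp add: algebra_simps add_divide_distrib)
  qed
  then have "(\<integral>\<^sup>+x. ennreal (rician_density K x * x) \<partial>lborel) \<le> ennreal 1"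
    using assms
    by (intro nn_integral_rician_density_le[where b = "\<lambda>k. (real k + 1) / (1 + K)"])
      (auto simp: nn_integral_gamma_density_mean)
  then show "(\<integral>\<^sup>+x. ennreal (rician_density K x * x) \<partial>lborel) \<le> 1"
    by simp
  \<comment> \<open>At k = 0 the first summand alone is the exact moment of the exponential law; the
    second is slack there, which lets one formula serve every k.\<close>
  define b where "b k = (if k = 0 then sqrt (pi * (1 + K)) else 0) + (1 + (1 + K) *
    (1 / (real k + 1) + 3 / ((real k + 1) * (real k + 2)))) / 2" for k
  have b: "(\<integral>\<^sup>+x. ennreal (gamma_density (real k + 1) (1 + K) x * (1 / sqrt x)) \<partial>lborel)
      \<le> ennreal (b k)" for k
  proof (cases "k = 0")
    case True
    have "(\<integral>\<^sup>+x. ennreal (gamma_density 1 (1 + K) x * (1 / sqrt x)) \<partial>lborel)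
        = (\<integral>\<^sup>+x. ennreal (gamma_density 1 (1 + K) x * x powr (- (1/2))) \<partial>lborel)"
      by (intro nn_integral_cong) (auto simp: gamma_density_def powr_minus_divide powr_half_sqrt)
    also have "\<dots> = ennreal (Gamma (1 + - (1/2)) / (Gamma 1 * (1 + K) powr (- (1/2))))"
      using assms by (intro nn_integral_gamma_density_powr) auto
    also have "\<dots> = ennreal (sqrt (pi * (1 + K)))"
      using assms
      by (simp add: Gamma_one_half_real powr_minus_divide powr_half_sqrt real_sqrt_mult)
    also have "\<dots> \<le> ennreal (b k)"
      using assms True by (intro ennreal_leI) (simp add: b_def)
    finally show ?thesis
      using True by simp
  next
    case False
    \<comment> \<open>The difference 1/k - 1/(k + 1) = 1/(k (k + 1)) is at most 3/((k + 1) (k + 2))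
      exactly when k + 2 \<le> 3 k. Equality at k = 1 makes 3 the least possible constant.\<close>
    then have "1 / real k \<le> 1 / (real k + 1) + 3 / ((real k + 1) * (real k + 2))"
      by (simp add: divide_simps) (simp add: algebra_simps)
    then have "(1 + K) * (1 / real k)
        \<le> (1 + K) * (1 / (real k + 1) + 3 / ((real k + 1) * (real k + 2)))"
      using assms by (intro mult_left_mono) auto
    from divide_right_mono[OF add_left_mono[OF this, of 1], of 2]
    have "(1 + (1 + K) / (real k + 1 - 1)) / 2 \<le> b k"
      using False by (simp add: b_def)
    then show ?thesis
      using nn_integral_gamma_density_inverse_sqrt_le[of "real k + 1" "1 + K"] False assms
      by (elim order_trans[rotated, OF ennreal_leI]) auto
  qed
  have b0: "b k \<ge> 0" for k
    using assms by (simp add: b_def)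
  \<comment> \<open>The tail probabilities are bounded by 1.\<close>
  have le1: "1 / K * (1 - (\<Sum>i<1. ?w i)) + 3 / K\<^sup>2 * (1 - (\<Sum>i<2. ?w i)) \<le> 1 / K + 3 / K\<^sup>2"
    using assms by (intro add_mono mult_left_le) (auto intro!: sum_nonneg)
  have "(\<lambda>k. ?w k * (if k = 0 then sqrt (pi * (1 + K)) else 0))
      sums (exp (- K) * sqrt (pi * (1 + K)))"
    using sums_single[of 0 "\<lambda>k. ?w k * sqrt (pi * (1 + K))"] by (simp add: if_distrib cong: if_cong)
  moreover have "(\<lambda>k. ?w k * (1 / (real k + 1) + 3 / ((real k + 1) * (real k + 2))))
      sums (1 / K * (1 - (\<Sum>i<1. ?w i)) + 3 / K\<^sup>2 * (1 - (\<Sum>i<2. ?w i)))" (is "_ sums ?S")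
  proof -
    \<comment> \<open>Absorbing k + 1 and k + 2 into the factorial raises the power of K by 1 and 2,
      which the prefactors 1/K and 3/K^2 undo.\<close>
    have "1 / K * (exp (- K) * K ^ (k + 1) / fact (k + 1))
          + 3 / K\<^sup>2 * (exp (- K) * K ^ (k + 2) / fact (k + 2))
        = ?w k * (1 / (real k + 1) + 3 / ((real k + 1) * (real k + 2)))" for k
    proof -
      have f: "fact (k + 1) = (real k + 1) * fact k"
        "fact (k + 2) = (real k + 2) * ((real k + 1) * fact k)"
        by (simp_all add: numeral_2_eq_2 algebra_simps)
      show ?thesis
        unfolding f using assms by (simp add: power_add power2_eq_square divide_simps)
          (simp add: algebra_simps)
    qed
    with sums_add[OF sums_mult[OF poisson_shift_sums] sums_mult[OF poisson_shift_sums],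
        of "1 / K" K 1 "3 / K\<^sup>2" K 2]
    show ?thesis by simp
  qed
  ultimately have "(\<lambda>k. ?w k * (if k = 0 then sqrt (pi * (1 + K)) else 0) + (?w k + (1 + K) *
      (?w k * (1 / (real k + 1) + 3 / ((real k + 1) * (real k + 2))))) / 2)
      sums (exp (- K) * sqrt (pi * (1 + K)) + (1 + (1 + K) * ?S) / 2)"
    by (intro sums_add sums_divide sums_mult poisson_sums)
  then have "(\<lambda>k. ?w k * b k) sums (exp (- K) * sqrt (pi * (1 + K)) + (1 + (1 + K) * ?S) / 2)"
    by (simp add: b_def algebra_simps add_divide_distrib)
  then have "(\<integral>\<^sup>+x. ennreal (rician_density K x * (1 / sqrt x)) \<partial>lborel)
      \<le> ennreal (exp (- K) * sqrt (pi * (1 + K)) + (1 + (1 + K) * ?S) / 2)"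
    using assms by (intro nn_integral_rician_density_le[OF _ _ _ b b0]) auto
  also have "\<dots> \<le> ennreal (rician_bound K)"
    unfolding rician_bound_def using assms le1
    by (intro ennreal_leI add_left_mono divide_right_mono mult_left_mono) auto
  finally show "(\<integral>\<^sup>+x. ennreal (rician_density K x * (1 / sqrt x)) \<partial>lborel)
      \<le> ennreal (rician_bound K)" .
  show "rician_bound K \<ge> 0"
    using assms by (simp add: rician_bound_def)
  show "rician_density K x \<ge> 0" for x
    using assms by (simp add: rician_density_nonneg)
qed (simp add: rician_density_def)

text \<open>The exponential kills the contribution of k = 0, and (1 + K) (1/K + 3/K^2) tends to
  1.\<close>

lemma rician_bound_tendsto: "(rician_bound \<longlongrightarrow> 1) at_top"
  unfolding rician_bound_def[abs_def] by real_asymp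

lemma nakagami_bound_tendsto: "((\<lambda>m::real. (1 + m / (m - 1)) / 2) \<longlongrightarrow> 1) at_top"
  by real_asymp

section \<open>Bounds on the EVM from the moment conditions\<close>

text \<open>Passage from nonnegative integrals to expectations. The square root is integrable
  because it is dominated by 1 + X.\<close>

lemma (in prob_space) unit_powerD:
  assumes "unit_power M u X"
  shows "X \<in> borel_measurable M" "AE \<omega> in M. X \<omega> > 0" "u \<ge> 0"
    "integrable M X" "expectation X \<le> 1"
    "integrable M (\<lambda>\<omega>. 1 / sqrt (X \<omega>))" "expectation (\<lambda>\<omega>. 1 / sqrt (X \<omega>)) \<le> u"
    "integrable M (\<lambda>\<omega>. sqrt (X \<omega>))"
proof -
  show [measurable]: "X \<in> borel_measurable M" and pos: "AE \<omega> in M. X \<omega> > 0" and u: "u \<ge> 0"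
    using assms by (auto simp: unit_power_def)
  have X: "(\<integral>\<^sup>+\<omega>. ennreal (X \<omega>) \<partial>M) \<le> ennreal 1"
    and I: "(\<integral>\<^sup>+\<omega>. ennreal (1 / sqrt (X \<omega>)) \<partial>M) \<le> ennreal u"
    using assms by (auto simp: unit_power_def)
  show "expectation X \<le> 1" "expectation (\<lambda>\<omega>. 1 / sqrt (X \<omega>)) \<le> u"
    using integral_real_bounded[OF _ X] integral_real_bounded[OF u I] by auto
  show iX: "integrable M X"
    using pos X by (intro integrableI_nonneg) (auto elim: order_le_less_trans)
  show "integrable M (\<lambda>\<omega>. 1 / sqrt (X \<omega>))"
    using pos I by (intro integrableI_nonneg) (auto elim: order_le_less_trans)
  have "AE \<omega> in M. norm (sqrt (X \<omega>)) \<le> norm (1 + X \<omega>)"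
    using pos
  proof eventually_elim
    case (elim \<omega>)
    then show ?case
      using arith_geo_mean_sqrt[of 1 "X \<omega>"] by simp
  qed
  moreover have "integrable M (\<lambda>\<omega>. 1 + X \<omega>)" "(\<lambda>\<omega>. sqrt (X \<omega>)) \<in> borel_measurable M"
    using iX by auto
  ultimately show "integrable M (\<lambda>\<omega>. sqrt (X \<omega>))"
    by (metis Bochner_Integration.integrable_bound)
qed

text \<open>The line (3 - x)/2 is the tangent at 1 of the convex function x^(-1/2); its expectation
  is at least 1 because the mean is at most 1.\<close>

lemma (in prob_space) unit_power_inverse_sqrt_ge:
  assumes "unit_power M u X"
  shows "1 \<le> expectation (\<lambda>\<omega>. 1 / sqrt (X \<omega>))"
proof -
  note X = unit_powerD[OF assms]
  have "1 \<le> expectation (\<lambda>\<omega>. (3 - X \<omega>) / 2)"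
    using X by (simp add: prob_space)
  also have "\<dots> \<le> expectation (\<lambda>\<omega>. 1 / sqrt (X \<omega>))"
  proof (intro integral_mono_AE)
    show "AE \<omega> in M. (3 - X \<omega>) / 2 \<le> 1 / sqrt (X \<omega>)"
      using X(2)
    proof eventually_elim
      case (elim \<omega>)
      define t where "t = sqrt (X \<omega>)"
      have t: "t > 0" "X \<omega> = t\<^sup>2"
        using elim by (auto simp: t_def)
      \<comment> \<open>Tangency at t = 1 shows up as a double root.\<close>
      have "2 - (3 - t\<^sup>2) * t = (t - 1)\<^sup>2 * (t + 2)"
        by (simp add: power2_eq_square algebra_simps)
      moreover have "(t - 1)\<^sup>2 * (t + 2) \<ge> 0"
        using t by simp
      ultimately show ?case
        using t by (simp add: t_def[symmetric] field_simps)
    qed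
  qed (use X in auto)
  finally show ?thesis .
qed

text \<open>Expectation of t + 1/t \<ge> 2 with t the square root of X.\<close>

lemma (in prob_space) unit_power_sqrt_ge:
  assumes "unit_power M u X"
  shows "2 - u \<le> expectation (\<lambda>\<omega>. sqrt (X \<omega>))"
proof -
  note X = unit_powerD[OF assms]
  have "2 - u \<le> expectation (\<lambda>\<omega>. 2 - 1 / sqrt (X \<omega>))"
    using X by (simp add: prob_space)
  also have "\<dots> \<le> expectation (\<lambda>\<omega>. sqrt (X \<omega>))"
  proof (intro integral_mono_AE)
    show "AE \<omega> in M. 2 - 1 / sqrt (X \<omega>) \<le> sqrt (X \<omega>)"
      using X(2)
    proof eventually_elim
      case (elim \<omega>)
      have "(sqrt (X \<omega>) - 1)\<^sup>2 \<ge> 0"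
        by simp
      then show ?case
        using elim by (simp add: power2_eq_square field_simps)
    qed
  qed (use X in auto)
  finally show ?thesis .
qed

text \<open>The integrand splits into a function of the desired power times a function of the
  interference, and these are independent.\<close>

lemma (in prob_space) EVM_eq:
  assumes indep: "indep_powers M L gd g"
    and "integrable M (\<lambda>\<omega>. sqrt (\<Sum>l=1..L. g l \<omega>))" "integrable M (\<lambda>\<omega>. 1 / sqrt (gd \<omega>))"
  shows "EVM M L gd g
    = expectation (\<lambda>\<omega>. 1 / sqrt (gd \<omega>)) * expectation (\<lambda>\<omega>. sqrt (\<Sum>l=1..L. g l \<omega>))"
proof -
  \<comment> \<open>This is the family from \<open>indep_powers\<close>; separating index 0 from the
    rest makes \<open>gd\<close> independent of the sum.\<close>
  define Y where "Y = (\<lambda>i. if i = 0 then gd else g i)"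
  have Y: "Y 0 = gd" "(\<Sum>l=1..L. Y l \<omega>) = (\<Sum>l=1..L. g l \<omega>)" for \<omega>
    by (auto simp: Y_def intro: sum.cong)
  have "{0..L} = insert 0 {1..L}"
    by auto
  then have "indep_vars (\<lambda>_. borel) Y (insert 0 {1..L})"
    using indep by (simp add: indep_powers_def Y_def)
  then have "indep_var borel (Y 0) borel (\<lambda>\<omega>. \<Sum>l=1..L. Y l \<omega>)"
    by (intro indep_vars_sum) auto
  then have "indep_var borel gd borel (\<lambda>\<omega>. \<Sum>l=1..L. g l \<omega>)"
    by (simp only: Y)
  then have "indep_var borel ((\<lambda>x. 1 / sqrt x) \<circ> gd) borel (sqrt \<circ> (\<lambda>\<omega>. \<Sum>l=1..L. g l \<omega>))"
    by (rule indep_var_compose) auto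
  then have "expectation (\<lambda>\<omega>. 1 / sqrt (gd \<omega>) * sqrt (\<Sum>l=1..L. g l \<omega>))
      = expectation (\<lambda>\<omega>. 1 / sqrt (gd \<omega>)) * expectation (\<lambda>\<omega>. sqrt (\<Sum>l=1..L. g l \<omega>))"
    using assms by (intro indep_var_lebesgue_integral) (simp_all add: comp_def)
  then show ?thesis
    by (simp add: EVM_def real_sqrt_divide)
qed

text \<open>The Cauchy-Schwarz inequality against the constant vector 1.\<close>

lemma sum_sqrt_le:
  fixes x :: "'a \<Rightarrow> real"
  assumes "\<And>i. i \<in> I \<Longrightarrow> x i \<ge> 0"
  shows "(\<Sum>i\<in>I. sqrt (x i)) \<le> sqrt (real (card I)) * sqrt (\<Sum>i\<in>I. x i)"
proof -
  have "(\<Sum>i\<in>I. sqrt (x i))\<^sup>2 \<le> (\<Sum>i\<in>I. x i) * real (card I)"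
    using sum_squared_le_sum_of_squares[of "\<lambda>i. sqrt (x i)" I] assms by simp
  then show ?thesis
    by (metis mult.commute real_le_rsqrt real_sqrt_mult)
qed

text \<open>The upper bound multiplies \<open>u\<close> by the bound \<open>sqrt L\<close> for the
  interference; the lower one multiplies \<open>sqrt L * (2 - v)\<close> by a factor at least 1 from
  the desired signal.\<close>

lemma (in prob_space) EVM_bounds:
  assumes "L \<ge> 1" and indep: "indep_powers M L gd g"
    and gd: "unit_power M u gd" and g: "\<And>l. l \<in> {1..L} \<Longrightarrow> unit_power M v (g l)"
  shows "sqrt (real L) * (2 - v) \<le> EVM M L gd g" "EVM M L gd g \<le> sqrt (real L) * u"
proof -
  let ?r = "sqrt (real L)"
  have r: "?r > 0" "?r * ?r = real L"
    using assms(1) by auto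
  let ?S = "\<lambda>\<omega>. \<Sum>l=1..L. g l \<omega>"
  note D = unit_powerD[OF gd] and G = unit_powerD[OF g]
  have pos: "AE \<omega> in M. \<forall>l\<in>{1..L}. g l \<omega> > 0"
    using G(2) by (intro AE_finite_allI) auto
  have [measurable]: "g l \<in> borel_measurable M" if "l \<in> {1..L}" for l
    using G(1) that .
  have S: "integrable M ?S" "expectation ?S \<le> real L"
    using G(4,5) sum_bounded_above[of "{1..L}" "\<lambda>l. expectation (g l)" 1] by auto
  \<comment> \<open>The arithmetic-geometric mean inequality for S / sqrt L and sqrt L, sharp at S =
    L, the value without fading.\<close>
  have upper: "AE \<omega> in M. sqrt (?S \<omega>) \<le> (?S \<omega> / ?r + ?r) / 2"
    using pos
  proof eventually_elim
    case (elim \<omega>)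
    then have "?S \<omega> \<ge> 0"
      by (intro sum_nonneg) (simp add: less_imp_le)
    then show ?case
      using arith_geo_mean_sqrt[of "?S \<omega> / ?r" ?r] r by simp
  qed
  have nonneg: "AE \<omega> in M. 0 \<le> sqrt (?S \<omega>)"
    using pos by eventually_elim (auto intro!: sum_nonneg simp: less_imp_le)
  have iS: "integrable M (\<lambda>\<omega>. sqrt (?S \<omega>))"
  proof (rule Bochner_Integration.integrable_bound)
    show "integrable M (\<lambda>\<omega>. (?S \<omega> / ?r + ?r) / 2)"
      using S(1) by simp
    show "AE \<omega> in M. norm (sqrt (?S \<omega>)) \<le> norm ((?S \<omega> / ?r + ?r) / 2)"
      using upper nonneg by eventually_elim simp
  qed measurable
  have "expectation (\<lambda>\<omega>. sqrt (?S \<omega>)) \<le> expectation (\<lambda>\<omega>. (?S \<omega> / ?r + ?r) / 2)"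
    using iS S(1) upper by (intro integral_mono_AE) auto
  also have "\<dots> = (expectation ?S / ?r + ?r) / 2"
    using S(1) by (simp add: prob_space)
  also have "\<dots> \<le> ?r"
    using divide_right_mono[OF S(2), of ?r] by (simp add: real_div_sqrt)
  finally have ES_le: "expectation (\<lambda>\<omega>. sqrt (?S \<omega>)) \<le> ?r" .
  have "real L * (2 - v) \<le> (\<Sum>l=1..L. expectation (\<lambda>\<omega>. sqrt (g l \<omega>)))"
    using sum_bounded_below[of "{1..L}" "2 - v" "\<lambda>l. expectation (\<lambda>\<omega>. sqrt (g l \<omega>))"]
      unit_power_sqrt_ge[OF g] by simp
  also have "\<dots> = expectation (\<lambda>\<omega>. \<Sum>l=1..L. sqrt (g l \<omega>))"
    using G(8) by simp
  also have "\<dots> \<le> expectation (\<lambda>\<omega>. ?r * sqrt (?S \<omega>))"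
  proof (intro integral_mono_AE)
    show "AE \<omega> in M. (\<Sum>l=1..L. sqrt (g l \<omega>)) \<le> ?r * sqrt (?S \<omega>)"
      using pos
    proof eventually_elim
      case (elim \<omega>)
      then show ?case
        using sum_sqrt_le[of "{1..L}" "\<lambda>l. g l \<omega>"] by (simp add: less_imp_le)
    qed
  qed (use G(8) iS in auto)
  finally have "?r * (?r * (2 - v)) \<le> ?r * expectation (\<lambda>\<omega>. sqrt (?S \<omega>))"
    using r(2) by (simp add: mult.assoc[symmetric])
  then have ES_ge: "?r * (2 - v) \<le> expectation (\<lambda>\<omega>. sqrt (?S \<omega>))"
    using r(1) by (simp only: mult_le_cancel_left_pos)
  \<comment> \<open>With this, the factor at least 1 can be multiplied onto the expectation itself,
    whatever the sign of 2 - v.\<close>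
  have ES0: "0 \<le> expectation (\<lambda>\<omega>. sqrt (?S \<omega>))"
    using nonneg by (rule integral_nonneg_AE)
  note eq = EVM_eq[OF indep iS D(6)]
  show "?r * (2 - v) \<le> EVM M L gd g"
    unfolding eq using mult_right_mono[OF unit_power_inverse_sqrt_ge[OF gd] ES0] ES_ge by simp
  show "EVM M L gd g \<le> ?r * u"
    unfolding eq using mult_mono[OF D(7) ES_le D(3) ES0] by (simp add: mult.commute)
qed

section \<open>The joint limit\<close>

text \<open>The lower bound depends on y alone and the upper bound on x alone, so the limit along
  the product filter reduces to two limits in one variable. The threshold \<open>c\<close> leaves
  room for moment bounds valid only for large parameters.\<close>

lemma EVM_tendsto:
  fixes M :: "real \<Rightarrow> real \<Rightarrow> 'a measure" and u :: "real \<Rightarrow> real"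
  assumes "L \<ge> 1" and u: "(u \<longlongrightarrow> 1) at_top"
    and M: "\<And>x y. x > c \<Longrightarrow> y > c \<Longrightarrow> prob_space (M x y) \<and> indep_powers (M x y) L (gd x y) (g x y)
      \<and> unit_power (M x y) (u x) (gd x y) \<and> (\<forall>l\<in>{1..L}. unit_power (M x y) (u y) (g x y l))"
  shows "((\<lambda>(x, y). EVM (M x y) L (gd x y) (g x y)) \<longlongrightarrow> sqrt (real L)) (at_top \<times>\<^sub>F at_top)"
proof (rule tendsto_sandwich)
  have bounds: "sqrt (real L) * (2 - u y) \<le> EVM (M x y) L (gd x y) (g x y)
      \<and> EVM (M x y) L (gd x y) (g x y) \<le> sqrt (real L) * u x" if "x > c" "y > c" for x y
    using prob_space.EVM_bounds[of "M x y" L "gd x y" "g x y" "u x" "u y"] M[OF that] assms(1)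
    by blast
  have ev: "\<forall>\<^sub>F p in at_top \<times>\<^sub>F at_top. fst p > c \<and> snd p > c"
    unfolding eventually_prod_filter using eventually_gt_at_top[of c]
    by (intro exI[of _ "\<lambda>x. x > c"]) auto
  show "\<forall>\<^sub>F p in at_top \<times>\<^sub>F at_top.
      sqrt (real L) * (2 - u (snd p)) \<le> (case p of (x, y) \<Rightarrow> EVM (M x y) L (gd x y) (g x y))"
    using ev by eventually_elim (use bounds in auto)
  show "\<forall>\<^sub>F p in at_top \<times>\<^sub>F at_top.
      (case p of (x, y) \<Rightarrow> EVM (M x y) L (gd x y) (g x y)) \<le> sqrt (real L) * u (fst p)"
    using ev by eventually_elim (use bounds in auto)
  have "((\<lambda>p. sqrt (real L) * (2 - u (snd p))) \<longlongrightarrow> sqrt (real L) * (2 - 1)) (at_top \<times>\<^sub>F at_top)"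
    by (intro tendsto_intros filterlim_compose[OF u filterlim_snd])
  then show "((\<lambda>p. sqrt (real L) * (2 - u (snd p))) \<longlongrightarrow> sqrt (real L)) (at_top \<times>\<^sub>F at_top)"
    by simp
  have "((\<lambda>p. sqrt (real L) * u (fst p)) \<longlongrightarrow> sqrt (real L) * 1) (at_top \<times>\<^sub>F at_top)"
    by (intro tendsto_intros filterlim_compose[OF u filterlim_fst])
  then show "((\<lambda>p. sqrt (real L) * u (fst p)) \<longlongrightarrow> sqrt (real L)) (at_top \<times>\<^sub>F at_top)"
    by simp
qed

theorem mainTheorem5:
  fixes L :: nat
  assumes "L \<ge> 1"
  shows
    "(\<forall>(M :: real \<Rightarrow> real \<Rightarrow> 'a measure) (gd :: real \<Rightarrow> real \<Rightarrow> 'a \<Rightarrow> real)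
        (g :: real \<Rightarrow> real \<Rightarrow> nat \<Rightarrow> 'a \<Rightarrow> real).
        (\<forall>K\<ge>0. \<forall>K\<^sub>I\<ge>0.
           prob_space (M K K\<^sub>I) \<and>
           indep_powers (M K K\<^sub>I) L (gd K K\<^sub>I) (g K K\<^sub>I) \<and>
           rician_power (M K K\<^sub>I) K (gd K K\<^sub>I) \<and>
           (\<forall>l\<in>{1..L}. rician_power (M K K\<^sub>I) K\<^sub>I (g K K\<^sub>I l))) \<longrightarrow>
        ((\<lambda>(K, K\<^sub>I). EVM (M K K\<^sub>I) L (gd K K\<^sub>I) (g K K\<^sub>I)) \<longlongrightarrow> sqrt (real L))
          (at_top \<times>\<^sub>F at_top)) \<and>
     (\<forall>(M :: real \<Rightarrow> real \<Rightarrow> 'a measure) (gd :: real \<Rightarrow> real \<Rightarrow> 'a \<Rightarrow> real)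
        (g :: real \<Rightarrow> real \<Rightarrow> nat \<Rightarrow> 'a \<Rightarrow> real).
        (\<forall>m>1/2. \<forall>m\<^sub>I>0.
           prob_space (M m m\<^sub>I) \<and>
           indep_powers (M m m\<^sub>I) L (gd m m\<^sub>I) (g m m\<^sub>I) \<and>
           nakagami_power (M m m\<^sub>I) m (gd m m\<^sub>I) \<and>
           (\<forall>l\<in>{1..L}. nakagami_power (M m m\<^sub>I) m\<^sub>I (g m m\<^sub>I l))) \<longrightarrow>
        ((\<lambda>(m, m\<^sub>I). EVM (M m m\<^sub>I) L (gd m m\<^sub>I) (g m m\<^sub>I)) \<longlongrightarrow> sqrt (real L))
          (at_top \<times>\<^sub>F at_top))"
proof (intro conjI allI impI, goal_cases)
  case (1 M gd g)
  show ?case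
  \<comment> \<open>The threshold 0 excludes K = 0, where the bound would divide by zero.\<close>
  proof (rule EVM_tendsto[OF assms rician_bound_tendsto, of 0])
    fix x y :: real assume xy: "x > 0" "y > 0"
    note * = 1[rule_format, OF less_imp_le[OF xy(1)] less_imp_le[OF xy(2)]]
    show "prob_space (M x y) \<and> indep_powers (M x y) L (gd x y) (g x y)
        \<and> unit_power (M x y) (rician_bound x) (gd x y)
        \<and> (\<forall>l\<in>{1..L}. unit_power (M x y) (rician_bound y) (g x y l))"
      using * xy prob_space.rician_unit_power[of "M x y"] by blast
  qed
next
  case (2 M gd g)
  show ?case
  \<comment> \<open>The threshold is 1, not 1/2, because the bound rests on the moment of order
    -1.\<close>
  proof (rule EVM_tendsto[OF assms nakagami_bound_tendsto, of 1])
    fix x y :: real assume xy: "x > 1" "y > 1"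
    then have "x > 1/2" "y > 0"
      by auto
    note * = 2[rule_format, OF this]
    show "prob_space (M x y) \<and> indep_powers (M x y) L (gd x y) (g x y)
        \<and> unit_power (M x y) ((1 + x / (x - 1)) / 2) (gd x y)
        \<and> (\<forall>l\<in>{1..L}. unit_power (M x y) ((1 + y / (y - 1)) / 2) (g x y l))"
      using * xy prob_space.nakagami_unit_power[of "M x y"] by blast
  qed
qed

end
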